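(* $\displaystyle\lim_{n\to\infty}\frac{\mu(n)}{n}=\frac12$.
   Context: $\mathbb{F}_2$ is the field with two elements. For $u\in\mathbb{F}_2^n$, $|u|$ is the number of entries of $u$ equal to $1$. For an $n\times n$ matrix $W$ over $\mathbb{F}_2$, $M(W,0)=\max\{|Wx| : x\in\mathbb{F}_2^n\}$. $\mu(n)$ is the minimum of $M(W,0)$ over all $n\times n$ matrices $W$ over $\mathbb{F}_2$ whose diagonal entries are all equal to $1$. *)

theory Defs
  imports Complex_Main "HOL-Library.Z2" "Jordan_Normal_Form.Matrix"
begin

definition hamming_weight :: "bit vec \<Rightarrow> nat" where
  "hamming_weight u = card {i. i < dim_vec u \<and> u $ i = 1}"

text \<open>This is \<open>M(W, 0)\<close>.\<close>

definition max_weight :: "bit mat \<Rightarrow> nat" where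
  "max_weight W = Max {hamming_weight (W *\<^sub>v x) | x. x \<in> carrier_vec (dim_col W)}"

definition mu :: "nat \<Rightarrow> nat" where
  "mu n = Min {max_weight W | W. W \<in> carrier_mat n n \<and> (\<forall>i<n. W $$ (i, i) = 1)}"

end

theory Submission imports Defs begin

text \<open>
  For the lower bound, the \<open>i\<close>-th coordinate of \<open>W x\<close> is 1 for at least half of all \<open>x\<close>, because
  adding the \<open>i\<close>-th unit vector to \<open>x\<close> flips it. So \<open>W x\<close> has weight at least \<open>n / 2\<close> on average.
  For the upper bound, fix \<open>k\<close> and let the columns of \<open>W\<close> be codewords of a repeated simplex code:
  give index \<open>i\<close> a nonempty subset \<open>S i\<close> of \<open>{..<k}\<close>, using all \<open>2^k - 1\<close> of them
  cyclically, choose \<open>t j \<in> S j\<close>, and let the \<open>(i, j)\<close> entry of \<open>W\<close> indicate \<open>t j \<in> S i\<close>.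
  Coordinate \<open>i\<close> of \<open>W x\<close> is then a linear functional of \<open>S i\<close>, which is 1 on at most \<open>2^(k-1)\<close>
  subsets. So \<open>\<mu>(n) / n\<close> is at most \<open>2^(k-1) / (2^k - 1) + O(1/n)\<close>.
\<close>

section \<open>Halving by a flip\<close>

text \<open>\<open>f\<close> sends the elements with \<open>P\<close> injectively to elements
  without \<open>P\<close>, so the former cannot outnumber the latter. Both bounds use this: subsets
  are flipped by toggling an element, vectors by adding a unit vector.\<close>

lemma card_le_half_if_flip:
  assumes "finite X" "inj_on f X" "f ` X \<subseteq> X" "\<And>x. x \<in> X \<Longrightarrow> P x \<Longrightarrow> \<not> P (f x)"
  shows "2 * card {x \<in> X. P x} \<le> card X"
proof -
  have "card {x \<in> X. P x} = card (f ` {x \<in> X. P x})"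
    using assms(2) by (intro card_image[symmetric]) (auto simp: inj_on_def)
  also have "\<dots> \<le> card {x \<in> X. \<not> P x}"
    using assms by (intro card_mono) auto
  finally have "2 * card {x \<in> X. P x} \<le> card {x \<in> X. P x} + card {x \<in> X. \<not> P x}"
    by simp
  also have "\<dots> = card ({x \<in> X. P x} \<union> {x \<in> X. \<not> P x})"
    using assms(1) by (intro card_Un_disjoint[symmetric]) auto
  also have "{x \<in> X. P x} \<union> {x \<in> X. \<not> P x} = X"
    by auto
  finally show ?thesis .
qed

text \<open>If \<open>y s = 1\<close>, toggling membership of \<open>s\<close> flips the sum; if no
  such \<open>s\<close> exists, every sum vanishes. In coding terms, a word of the simplex code is 1
  in at most half of the positions, the empty set counted as a position.\<close>

lemma card_odd_subsets_le:
  fixes y :: "'a \<Rightarrow> bit"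
  assumes "finite K"
  shows "2 * card {S \<in> Pow K. sum y S = 1} \<le> 2 ^ card K"
proof (cases "\<exists>s\<in>K. y s = 1")
  case True
  then obtain s where s: "s \<in> K" "y s = 1" by auto
  define f where "f S = (if s \<in> S then S - {s} else insert s S)" for S
  \<comment> \<open>Removing \<open>s\<close> subtracts 1, which over \<open>bit\<close> is the same
    as adding 1.\<close>
  have flip: "sum y (f S) = sum y S + 1" if "S \<subseteq> K" for S
  proof -
    have "finite S" using that assms finite_subset by auto
    then show ?thesis
      using s sum.remove[of S s y] by (auto simp: f_def add.commute)
  qed
  have "f (f S) = S" for S by (auto simp: f_def)
  then have "inj f" by (metis injI)
  have "2 * card {S \<in> Pow K. sum y S = 1} \<le> card (Pow K)"
  proof (rule card_le_half_if_flip)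
    show "inj_on f (Pow K)" using \<open>inj f\<close> by (rule inj_on_subset) simp
    show "f ` Pow K \<subseteq> Pow K" using s by (auto simp: f_def)
  qed (use assms flip in auto)
  then show ?thesis using assms by (simp add: card_Pow)
next
  case False
  then have "sum y S = 0" if "S \<subseteq> K" for S
    using that by (intro sum.neutral) auto
  then have "{S \<in> Pow K. sum y S = 1} = {}" by auto
  then show ?thesis by (simp only: card.empty mult_0_right le0)
qed

section \<open>Maximal weights and the lower bound\<close>

lemma hamming_weight_le_dim: "hamming_weight u \<le> dim_vec u"
proof -
  have "card {i. i < dim_vec u \<and> u $ i = 1} \<le> card {..<dim_vec u}"
    by (intro card_mono) auto
  then show ?thesis by (simp add: hamming_weight_def)
qed

lemma finite_hamming_weights:
  "finite {hamming_weight (W *\<^sub>v x) | x. x \<in> carrier_vec (dim_col W)}"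
proof (rule finite_subset)
  show "{hamming_weight (W *\<^sub>v x) | x. x \<in> carrier_vec (dim_col W)} \<subseteq> {..dim_row W}"
    using hamming_weight_le_dim[of "W *\<^sub>v x" for x] by auto
qed simp

lemma hamming_weight_le_max_weight:
  assumes "x \<in> carrier_vec (dim_col W)"
  shows "hamming_weight (W *\<^sub>v x) \<le> max_weight W"
  unfolding max_weight_def using assms finite_hamming_weights by (intro Max_ge) auto

lemma max_weight_attained:
  obtains x where "x \<in> carrier_vec (dim_col W)" "max_weight W = hamming_weight (W *\<^sub>v x)"
proof -
  have "0\<^sub>v (dim_col W) \<in> carrier_vec (dim_col W)" by simp
  then have "max_weight W \<in> {hamming_weight (W *\<^sub>v x) | x. x \<in> carrier_vec (dim_col W)}"
    unfolding max_weight_def using finite_hamming_weights by (intro Max_in) blast+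
  then show ?thesis using that by blast
qed

lemma finite_carrier_vec_bit: "finite (carrier_vec n :: bit vec set)"
proof (rule finite_subset)
  show "(carrier_vec n :: bit vec set) \<subseteq> (\<lambda>S. vec n (\<lambda>i. of_bool (i \<in> S))) ` Pow {..<n}"
  proof
    fix x :: "bit vec"
    assume x: "x \<in> carrier_vec n"
    then have "x = vec n (\<lambda>i. of_bool (i \<in> {i. i < n \<and> x $ i = 1}))"
      by (intro eq_vecI) auto
    then show "x \<in> (\<lambda>S. vec n (\<lambda>i. of_bool (i \<in> S))) ` Pow {..<n}" by blast
  qed
qed simp

lemma dim_le_twice_max_weight:
  assumes W: "W \<in> carrier_mat n n" and diag: "\<And>i. i < n \<Longrightarrow> W $$ (i, i) = 1"
  shows "n \<le> 2 * max_weight W"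
proof -
  define X where "X = (carrier_vec n :: bit vec set)"
  have fin: "finite X" unfolding X_def by (rule finite_carrier_vec_bit)
  have "0\<^sub>v n \<in> X" by (simp add: X_def)
  then have pos: "card X > 0" using fin by (auto simp: card_gt_0_iff)
  have half: "card X \<le> 2 * card {x \<in> X. (W *\<^sub>v x) $ i = 1}" if i: "i < n" for i
  proof -
    \<comment> \<open>Adding the unit vector to \<open>x\<close> adds column \<open>i\<close> of
      \<open>W\<close> to the product, and entry \<open>i\<close> of that column is the diagonal
      entry 1.\<close>
    have flip: "(W *\<^sub>v (x + unit_vec n i)) $ i = (W *\<^sub>v x) $ i + 1" if "x \<in> X" for x
      using that W i diag[OF i] by (auto simp: X_def mult_add_distrib_mat_vec[OF W])
    \<comment> \<open>The flip bounds the complement from above, so the value 1 is taken on at least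
      half of \<open>X\<close>.\<close>
    have "2 * card {x \<in> X. (W *\<^sub>v x) $ i \<noteq> 1} \<le> card X"
    proof (rule card_le_half_if_flip[OF fin])
      show "inj_on (\<lambda>x. x + unit_vec n i) X"
      proof (rule inj_onI)
        fix x y
        assume X: "x \<in> X" "y \<in> X" and eq: "x + unit_vec n i = y + unit_vec n i"
        show "x = y"
        proof (rule eq_vecI)
          fix j assume "j < dim_vec y"
          then have "x $ j + unit_vec n i $ j = y $ j + unit_vec n i $ j"
            using X arg_cong[OF eq, of "\<lambda>v. v $ j"] by (simp add: X_def)
          then show "x $ j = y $ j" by (rule add_right_imp_eq)
        qed (use X in \<open>auto simp: X_def\<close>)
      qed
    qed (use flip in \<open>auto simp: X_def\<close>)
    moreover have "card X = card ({x \<in> X. (W *\<^sub>v x) $ i = 1} \<union> {x \<in> X. (W *\<^sub>v x) $ i \<noteq> 1})"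
      by (rule arg_cong[where f = card]) auto
    moreover have "\<dots> = card {x \<in> X. (W *\<^sub>v x) $ i = 1} + card {x \<in> X. (W *\<^sub>v x) $ i \<noteq> 1}"
      using fin by (intro card_Un_disjoint) auto
    ultimately show ?thesis by linarith
  qed
  \<comment> \<open>Double counting of the pairs of \<open>i\<close> and \<open>x\<close> with
    \<open>(W *\<^sub>v x) $ i = 1\<close>: each \<open>i\<close> lies in at least
    \<open>card X / 2\<close> of them, each \<open>x\<close> in at most
    \<open>max_weight W\<close>.\<close>
  have "n * card X = (\<Sum>i<n. card X)" by simp
  also have "\<dots> \<le> (\<Sum>i<n. 2 * card {x \<in> X. (W *\<^sub>v x) $ i = 1})"
    using half by (intro sum_mono) auto
  also have "\<dots> = 2 * (\<Sum>i<n. \<Sum>x\<in>X. of_bool ((W *\<^sub>v x) $ i = 1))"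
    using fin by (simp add: sum_distrib_left of_bool_def sum.If_cases Int_def)
  also have "\<dots> = 2 * (\<Sum>x\<in>X. \<Sum>i<n. of_bool ((W *\<^sub>v x) $ i = 1))"
    by (subst sum.swap) simp
  also have "\<dots> = 2 * (\<Sum>x\<in>X. hamming_weight (W *\<^sub>v x))"
    using W
    by (simp add: hamming_weight_def of_bool_def sum.If_cases Int_def del: index_mult_mat_vec)
  also have "\<dots> \<le> 2 * (\<Sum>x\<in>X. max_weight W)"
    using W by (intro mult_left_mono sum_mono hamming_weight_le_max_weight) (auto simp: X_def)
  finally show ?thesis using pos by simp
qed

lemma finite_max_weights:
  "finite {max_weight W | W. W \<in> carrier_mat n n \<and> (\<forall>i<n. W $$ (i, i) = 1)}"
proof (rule finite_subset)
  have "max_weight W \<le> n" if "W \<in> carrier_mat n n" for W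
    using that max_weight_attained[of W] hamming_weight_le_dim[of "W *\<^sub>v x" for x]
    by (metis carrier_matD(1) dim_mult_mat_vec)
  then show "{max_weight W | W. W \<in> carrier_mat n n \<and> (\<forall>i<n. W $$ (i, i) = 1)} \<subseteq> {..n}"
    by auto
qed simp

lemma mu_le_max_weight:
  assumes "W \<in> carrier_mat n n" "\<And>i. i < n \<Longrightarrow> W $$ (i, i) = 1"
  shows "mu n \<le> max_weight W"
  unfolding mu_def using assms finite_max_weights by (intro Min_le) auto

lemma le_twice_mu: "n \<le> 2 * mu n"
proof -
  \<comment> \<open>The identity matrix makes the set of maximal weights nonempty, so its minimum is
    attained by some matrix.\<close>
  have "1\<^sub>m n \<in> carrier_mat n n \<and> (\<forall>i<n. 1\<^sub>m n $$ (i, i) = (1 :: bit))" by simp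
  then have "mu n \<in> {max_weight W | W. W \<in> carrier_mat n n \<and> (\<forall>i<n. W $$ (i, i) = 1)}"
    unfolding mu_def using finite_max_weights by (intro Min_in) blast+
  then show ?thesis using dim_le_twice_max_weight by auto
qed

section \<open>The simplex code and the upper bound\<close>

text \<open>Writing \<open>i = c + q * N\<close> with \<open>q \<le> n div N\<close> shows that each
  residue \<open>c\<close> occurs at most \<open>n div N + 1\<close> times below
  \<open>n\<close>.\<close>

lemma card_mod_le:
  fixes N :: nat
  assumes "N > 0"
  shows "card {i. i < n \<and> P (i mod N)} \<le> card {c. c < N \<and> P c} * (n div N + 1)"
proof -
  have "{i. i < n \<and> P (i mod N)} \<subseteq> (\<lambda>(c, q). c + q * N) ` ({c. c < N \<and> P c} \<times> {..n div N})"
  proof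
    fix i assume i: "i \<in> {i. i < n \<and> P (i mod N)}"
    have "i div N \<le> n div N" using i by (intro div_le_mono) auto
    then show "i \<in> (\<lambda>(c, q). c + q * N) ` ({c. c < N \<and> P c} \<times> {..n div N})"
      using i assms by (intro image_eqI[where x = "(i mod N, i div N)"]) auto
  qed
  then have "card {i. i < n \<and> P (i mod N)} \<le> card ({c. c < N \<and> P c} \<times> {..n div N})"
    by (rule surj_card_le[rotated]) simp
  then show ?thesis by (simp add: card_cartesian_product)
qed

text \<open>The ground set has \<open>Suc k\<close> elements here, so that there is a nonempty
  subset even for \<open>k = 0\<close> and half of its power set is exactly
  \<open>2 ^ k\<close>.\<close>

lemma mu_le_simplex:
  "mu n \<le> 2 ^ k * (n div (2 ^ Suc k - 1) + 1)"
proof -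
  define N :: nat where "N = 2 ^ Suc k - 1"
  define K where "K = {..<Suc k}"
  have "1 < (2 :: nat) ^ Suc k" by (intro one_less_power) auto
  then have N: "N > 0" by (simp only: N_def zero_less_diff)
  have "card (Pow K - {{}}) = N"
    by (simp add: K_def N_def card_Pow card_Diff_singleton)
  then obtain S where S: "bij_betw S {..<N} (Pow K - {{}})"
    by (metis K_def ex_bij_betw_nat_finite finite_Diff finite_Pow_iff finite_lessThan
        atLeast0LessThan)
  have SK: "S c \<subseteq> K" "S c \<noteq> {}" if "c < N" for c
    using bij_betwE[OF S] that by auto
  \<comment> \<open>Choosing \<open>t j\<close> inside the subset of index \<open>j\<close> is what
    puts 1 on the diagonal of \<open>W\<close>.\<close>
  define t where "t j = (SOME s. s \<in> S (j mod N))" for j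
  have t: "t j \<in> S (j mod N)" for j
    unfolding t_def using SK(2)[of "j mod N"] N by (intro some_in_eq[THEN iffD2]) simp
  define W :: "bit mat" where "W = mat n n (\<lambda>(i, j). of_bool (t j \<in> S (i mod N)))"
  have W: "W \<in> carrier_mat n n" by (simp add: W_def)
  obtain x where x: "x \<in> carrier_vec n" and max: "max_weight W = hamming_weight (W *\<^sub>v x)"
    using max_weight_attained[of W] W by auto
  \<comment> \<open>Column \<open>j\<close> of \<open>W\<close> depends on \<open>t j\<close> only,
    so \<open>W *\<^sub>v x\<close> depends on \<open>x\<close> only through the sums of
    \<open>x\<close> over the fibres of \<open>t\<close>.\<close>
  define y where "y s = (\<Sum>j | j < n \<and> t j = s. x $ j)" for s
  have Wx: "(W *\<^sub>v x) $ i = sum y (S (i mod N))" if "i < n" for i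
  proof -
    have fin: "finite (S (i mod N))"
      using SK(1)[of "i mod N"] N by (auto simp: K_def intro: finite_subset)
    have "(W *\<^sub>v x) $ i = (\<Sum>j<n. of_bool (t j \<in> S (i mod N)) * x $ j)"
      using that x by (simp add: W_def scalar_prod_def atLeast0LessThan)
    also have "\<dots> = (\<Sum>j | j < n \<and> t j \<in> S (i mod N). x $ j)"
      by (rule sum.mono_neutral_cong_right) auto
    also have "\<dots> = (\<Sum>s\<in>S (i mod N). \<Sum>j | j \<in> {j. j < n \<and> t j \<in> S (i mod N)} \<and> t j = s. x $ j)"
      using fin by (intro sum.group[symmetric]) auto
    also have "\<dots> = sum y (S (i mod N))"
      unfolding y_def by (intro sum.cong) auto
    finally show ?thesis .
  qed
  \<comment> \<open>Within one period distinct indices carry distinct subsets, so counting indices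
    reduces to counting subsets with sum 1.\<close>
  have "card {c. c < N \<and> sum y (S c) = 1} \<le> card {S \<in> Pow K. sum y S = 1}"
  proof (rule card_inj_on_le)
    show "inj_on S {c. c < N \<and> sum y (S c) = 1}"
      using S by (auto simp: bij_betw_def inj_on_def)
    show "S ` {c. c < N \<and> sum y (S c) = 1} \<subseteq> {S \<in> Pow K. sum y S = 1}"
      using SK by auto
    show "finite {S \<in> Pow K. sum y S = 1}" by (simp add: K_def)
  qed
  also have "\<dots> \<le> 2 ^ k"
    using card_odd_subsets_le[of K y] by (simp add: K_def)
  finally have half: "card {c. c < N \<and> sum y (S c) = 1} \<le> 2 ^ k" .
  have "mu n \<le> max_weight W" using W t by (intro mu_le_max_weight) (auto simp: W_def)
  also have "\<dots> = card {i. i < n \<and> sum y (S (i mod N)) = 1}"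
    unfolding max hamming_weight_def using Wx
    by (intro arg_cong[where f = card]) (auto simp: W_def)
  also have "\<dots> \<le> card {c. c < N \<and> sum y (S c) = 1} * (n div N + 1)"
    by (rule card_mod_le[OF N])
  also have "\<dots> \<le> 2 ^ k * (n div N + 1)"
    using half by (rule mult_right_mono) simp
  finally show ?thesis by (simp add: N_def)
qed

theorem theorem1p2:
  shows "(\<lambda>n. real (mu n) / real n) \<longlonglongrightarrow> 1 / 2"
proof (rule order_tendstoI)
  fix a :: real
  assume "a < 1 / 2"
  \<comment> \<open>The case \<open>n = 0\<close> is excluded because there the quotient is 0 by
    convention.\<close>
  have lower: "1 / 2 \<le> real (mu n) / real n" if "n > 0" for n
    using le_twice_mu[of n] that by (simp add: field_simps)
  show "\<forall>\<^sub>F n in sequentially. a < real (mu n) / real n"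
    using eventually_gt_at_top[of "0 :: nat"]
    by eventually_elim (rule less_le_trans[OF \<open>a < 1 / 2\<close> lower])
next
  fix a :: real
  assume a: "1 / 2 < a"
  \<comment> \<open>\<open>r k\<close> is the density of ones in a nonzero word of the simplex code
    of dimension \<open>Suc k\<close>. Cancelling \<open>2 ^ k\<close> shows that it tends to
    1/2.\<close>
  define r :: "nat \<Rightarrow> real" where "r k = 2 ^ k / (2 ^ Suc k - 1)" for k
  have "(\<lambda>k. 1 / (2 - (1 / 2) ^ k)) \<longlonglongrightarrow> 1 / (2 - 0 :: real)"
    by (intro tendsto_intros) auto
  moreover have "1 / (2 - (1 / 2) ^ k) = r k" for k
    by (simp add: r_def field_simps)
  ultimately have "r \<longlonglongrightarrow> 1 / 2" by simp
  \<comment> \<open>Fixing \<open>k\<close> before \<open>n\<close> grows leaves the positive gap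
    \<open>a - r k\<close> to absorb the rounding error.\<close>
  then obtain k where k: "r k < a"
    using order_tendstoD(2)[OF _ a] eventually_sequentially by (metis order_refl)
  \<comment> \<open>The error \<open>2 ^ k / real n\<close> comes from the last, possibly incomplete
    period of the repeated code; it vanishes for fixed \<open>k\<close>.\<close>
  have bound: "real (mu n) / real n \<le> r k + 2 ^ k / real n" if "n > 0" for n
  proof -
    have N: "real (2 ^ Suc k - 1) = 2 ^ Suc k - 1" by (simp add: of_nat_diff)
    have quot: "real (n div (2 ^ Suc k - 1)) \<le> real n / (2 ^ Suc k - 1)"
      using of_nat_div_le_of_nat[of n "2 ^ Suc k - 1", where 'a = real] unfolding N .
    have "real (mu n) \<le> real (2 ^ k * (n div (2 ^ Suc k - 1) + 1))"
      using mu_le_simplex of_nat_le_iff by blast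
    also have "\<dots> = 2 ^ k * (real (n div (2 ^ Suc k - 1)) + 1)"
      by (simp add: distrib_left)
    also have "\<dots> \<le> 2 ^ k * (real n / (2 ^ Suc k - 1) + 1)"
      by (intro mult_left_mono add_right_mono quot) simp
    finally have "real (mu n) / real n \<le> 2 ^ k * (real n / (2 ^ Suc k - 1) + 1) / real n"
      by (rule divide_right_mono) simp
    also have "\<dots> = r k + 2 ^ k / real n"
      using that by (simp add: r_def distrib_left add_divide_distrib)
    finally show ?thesis .
  qed
  have "(\<lambda>n. r k + 2 ^ k / real n) \<longlonglongrightarrow> r k + 0"
    by (intro tendsto_add tendsto_const lim_const_over_n)
  then have "\<forall>\<^sub>F n in sequentially. r k + 2 ^ k / real n < a"
    using k by (intro order_tendstoD(2)) auto
  then show "\<forall>\<^sub>F n in sequentially. real (mu n) / real n < a"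
    using eventually_gt_at_top[of "0 :: nat"]
    by eventually_elim (rule le_less_trans[OF bound])
qed

end
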